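(* Let $f\in\mathbb{C}[h]$ with $\deg f>1$. Then $\mathcal{H}(f)$ has no nonzero locally nilpotent derivations.
   Context: For a polynomial $f\in\mathbb{C}[h]$, the generalized Heisenberg algebra $\mathcal{H}(f)$ is the unital associative $\mathbb{C}$-algebra with generators $x,y,h$ and defining relations $$hx=xf(h),\qquad yh=f(h)y,\qquad yx-xy=f(h)-h.$$ Here $\deg f$ is the degree of $f$ as a polynomial in $h$. A derivation of $\mathcal{H}(f)$ is a $\mathbb{C}$-linear endomorphism $\delta$ of $\mathcal{H}(f)$ with $\delta(ab)=\delta(a)b+a\delta(b)$ for all $a,b\in\mathcal{H}(f)$. It is locally nilpotent if for every $a\in\mathcal{H}(f)$ there is $k\in\mathbb{Z}_{\geq 0}$ such that $\delta^k(a)=0$. *)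

theory Defs
  imports
    "HOL-Algebra.Module"
    "HOL-Algebra.QuotRing"
    "HOL-Library.Poly_Mapping"
    "HOL-Computational_Algebra.Polynomial"
begin

section \<open>The free algebra on three generators\<close>

datatype gen = GenX | GenY | GenH

text \<open>
  Words are wrapped in a datatype of their own so that they can be made a (noncommutative)
  additive monoid under concatenation. The convolution product of \<^type>\<open>poly_mapping\<close> is then the
  product of the monoid algebra of the free monoid, that is, of the free associative algebra.
\<close>

datatype word = Word (letters: "gen list")

instantiation word :: monoid_add
begin

definition zero_word :: word where
  "0 = Word []"

definition plus_word :: "word \<Rightarrow> word \<Rightarrow> word" where
  "u + v = Word (letters u @ letters v)"

instance
  by standard (simp_all add: zero_word_def plus_word_def)

end

type_synonym free_poly = "word \<Rightarrow>\<^sub>0 complex"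

definition gen_poly :: "gen \<Rightarrow> free_poly" where
  "gen_poly g = Poly_Mapping.single (Word [g]) 1"

definition const_poly :: "complex \<Rightarrow> free_poly" where
  "const_poly c = Poly_Mapping.single 0 c"

definition free_algebra :: "(complex, free_poly) module" where
  "free_algebra =
    \<lparr>carrier = UNIV, monoid.mult = (\<lambda>a b. a * b), one = 1, ring.zero = 0, add = (\<lambda>a b. a + b),
     module.smult = (\<lambda>c a. const_poly c * a)\<rparr>"

text \<open>
  \<^const>\<open>poly\<close> needs commutative coefficients, so evaluation of a complex polynomial at an
  element of the free algebra is written out.
\<close>

definition eval_at :: "complex poly \<Rightarrow> free_poly \<Rightarrow> free_poly" where
  "eval_at f a = (\<Sum>i\<le>degree f. const_poly (coeff f i) * a ^ i)"


section \<open>Generalized Heisenberg algebras\<close>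

definition heisenberg_relations :: "complex poly \<Rightarrow> free_poly set" where
  "heisenberg_relations f =
    (let x = gen_poly GenX; y = gen_poly GenY; h = gen_poly GenH; fh = eval_at f h
     in {h * x - x * fh, y * h - fh * y, (y * x - x * y) - (fh - h)})"

text \<open>The ideals of HOL-Algebra are two-sided.\<close>

definition heisenberg_ideal :: "complex poly \<Rightarrow> free_poly set" where
  "heisenberg_ideal f = genideal free_algebra (heisenberg_relations f)"

text \<open>
  \<^const>\<open>FactRing\<close> yields a bare ring; the scalar multiplication induced on the cosets is
  added to it.
\<close>

definition heisenberg_algebra :: "complex poly \<Rightarrow> (complex, free_poly set) module" where
  "heisenberg_algebra f =
    ring.extend (FactRing free_algebra (heisenberg_ideal f))
      (module.fields (\<lambda>c A.
        \<Union>a\<in>A. a_r_coset free_algebra (heisenberg_ideal f) (c \<odot>\<^bsub>free_algebra\<^esub> a)))"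


section \<open>Locally nilpotent derivations\<close>

text \<open>
  Only the values of \<open>\<delta>\<close> on the carrier matter; in particular, \<open>\<delta>\<close> is zero as an
  endomorphism of \<open>A\<close> iff it vanishes on the carrier.
\<close>

definition is_derivation :: "(complex, 'a, 'm) module_scheme \<Rightarrow> ('a \<Rightarrow> 'a) \<Rightarrow> bool" where
  "is_derivation A \<delta> \<longleftrightarrow>
    \<delta> \<in> carrier A \<rightarrow> carrier A \<and>
    (\<forall>a\<in>carrier A. \<forall>b\<in>carrier A. \<delta> (a \<oplus>\<^bsub>A\<^esub> b) = \<delta> a \<oplus>\<^bsub>A\<^esub> \<delta> b) \<and>
    (\<forall>c. \<forall>a\<in>carrier A. \<delta> (c \<odot>\<^bsub>A\<^esub> a) = c \<odot>\<^bsub>A\<^esub> \<delta> a) \<and>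
    (\<forall>a\<in>carrier A. \<forall>b\<in>carrier A.
      \<delta> (a \<otimes>\<^bsub>A\<^esub> b) = (\<delta> a \<otimes>\<^bsub>A\<^esub> b) \<oplus>\<^bsub>A\<^esub> (a \<otimes>\<^bsub>A\<^esub> \<delta> b))"

definition is_locally_nilpotent :: "(complex, 'a, 'm) module_scheme \<Rightarrow> ('a \<Rightarrow> 'a) \<Rightarrow> bool" where
  "is_locally_nilpotent A \<delta> \<longleftrightarrow> (\<forall>a\<in>carrier A. \<exists>k. (\<delta> ^^ k) a = \<zero>\<^bsub>A\<^esub>)"


section \<open>The quotient is an algebra satisfying the relations\<close>

lemma ring_free_algebra: "ring free_algebra"
proof (rule ringI)
  show "abelian_group free_algebra"
  proof (rule abelian_groupI)
    fix a assume "a \<in> carrier free_algebra"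
    show "\<exists>b\<in>carrier free_algebra. b \<oplus>\<^bsub>free_algebra\<^esub> a = \<zero>\<^bsub>free_algebra\<^esub>"
      by (rule bexI[of _ "- a"]) (simp_all add: free_algebra_def)
  qed (simp_all add: free_algebra_def add_ac)
  show "monoid free_algebra"
    by (rule monoidI) (simp_all add: free_algebra_def mult.assoc)
qed (simp_all add: free_algebra_def algebra_simps)

lemma ideal_heisenberg_ideal: "ideal (heisenberg_ideal f) free_algebra"
  unfolding heisenberg_ideal_def
  by (rule ring.genideal_ideal[OF ring_free_algebra]) (simp add: free_algebra_def)

definition heisenberg_coset :: "complex poly \<Rightarrow> free_poly \<Rightarrow> free_poly set" where
  "heisenberg_coset f a = a_r_coset free_algebra (heisenberg_ideal f) a"

lemma heisenberg_algebra_sel: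
  "carrier (heisenberg_algebra f) = range (heisenberg_coset f)"
  "\<one>\<^bsub>heisenberg_algebra f\<^esub> = heisenberg_coset f 1"
  "\<zero>\<^bsub>heisenberg_algebra f\<^esub> = heisenberg_coset f 0"
  "heisenberg_coset f a \<otimes>\<^bsub>heisenberg_algebra f\<^esub> heisenberg_coset f b = heisenberg_coset f (a * b)"
  "heisenberg_coset f a \<oplus>\<^bsub>heisenberg_algebra f\<^esub> heisenberg_coset f b = heisenberg_coset f (a + b)"
  "c \<odot>\<^bsub>heisenberg_algebra f\<^esub> heisenberg_coset f a = heisenberg_coset f (const_poly c * a)"
proof -
  interpret I: ideal "heisenberg_ideal f" free_algebra by (rule ideal_heisenberg_ideal)
  have UN: "a \<in> carrier free_algebra" for a by (simp add: free_algebra_def)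
  note d = heisenberg_algebra_def heisenberg_coset_def ring.defs module.defs FactRing_def
  show "carrier (heisenberg_algebra f) = range (heisenberg_coset f)"
    unfolding d A_RCOSETS_def' by (auto simp: free_algebra_def)
  show "\<one>\<^bsub>heisenberg_algebra f\<^esub> = heisenberg_coset f 1"
    unfolding d by (simp add: free_algebra_def)
  show "\<zero>\<^bsub>heisenberg_algebra f\<^esub> = heisenberg_coset f 0"
    using I.a_coset_add_zero[OF I.a_subset] unfolding d by (simp add: free_algebra_def)
  show "heisenberg_coset f a \<otimes>\<^bsub>heisenberg_algebra f\<^esub> heisenberg_coset f b
      = heisenberg_coset f (a * b)"
    using I.rcoset_mult_add[OF UN UN, of a b] unfolding d by (simp add: free_algebra_def)
  show "heisenberg_coset f a \<oplus>\<^bsub>heisenberg_algebra f\<^esub> heisenberg_coset f b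
      = heisenberg_coset f (a + b)"
    using I.a_rcos_sum[OF UN UN, of a b] unfolding d by (simp add: free_algebra_def)
  have *: "a_r_coset free_algebra (heisenberg_ideal f) (const_poly c * b)
      = a_r_coset free_algebra (heisenberg_ideal f) (const_poly c * a)"
    if b: "b \<in> a_r_coset free_algebra (heisenberg_ideal f) a" for b
  proof -
    have eq: "a_r_coset free_algebra (heisenberg_ideal f) a
        = a_r_coset free_algebra (heisenberg_ideal f) b"
      by (rule I.a_repr_independence[OF b UN I.a_subgroup])
    show ?thesis
      using I.rcoset_mult_add[OF UN UN, of "const_poly c" a]
        I.rcoset_mult_add[OF UN UN, of "const_poly c" b] eq
      by (simp add: free_algebra_def)
  qed
  show "c \<odot>\<^bsub>heisenberg_algebra f\<^esub> heisenberg_coset f a = heisenberg_coset f (const_poly c * a)"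
  proof -
    have "(\<Union>b\<in>a_r_coset free_algebra (heisenberg_ideal f) a.
        a_r_coset free_algebra (heisenberg_ideal f) (const_poly c * b))
      = a_r_coset free_algebra (heisenberg_ideal f) (const_poly c * a)"
      using I.a_rcos_self[OF UN, of a] by (intro SUP_eq_const) (blast, rule *)
    moreover have "c \<odot>\<^bsub>free_algebra\<^esub> b = const_poly c * b" for b
      by (simp add: free_algebra_def)
    ultimately show ?thesis unfolding d by simp
  qed
qed

lemma ring_heisenberg_algebra: "ring (heisenberg_algebra f)"
proof (rule ringI)
  note s = heisenberg_algebra_sel
  show "abelian_group (heisenberg_algebra f)"
  proof (rule abelian_groupI)
    fix A assume "A \<in> carrier (heisenberg_algebra f)"
    then obtain a where A: "A = heisenberg_coset f a" by (auto simp: s)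
    show "\<exists>B\<in>carrier (heisenberg_algebra f). B \<oplus>\<^bsub>heisenberg_algebra f\<^esub> A = \<zero>\<^bsub>heisenberg_algebra f\<^esub>"
      by (rule bexI[of _ "heisenberg_coset f (- a)"]) (simp_all add: A s)
  qed (auto simp: s add_ac)
  show "monoid (heisenberg_algebra f)"
    by (rule monoidI) (auto simp: s mult.assoc)
qed (auto simp: heisenberg_algebra_sel algebra_simps)

lemma const_poly_central: "const_poly c * a = a * const_poly c"
proof (induction a rule: update_induct)
  case (update a k v)
  have "Poly_Mapping.update k v a = a + Poly_Mapping.single k v"
    using update by (intro poly_mapping_eqI)
      (auto simp: update.rep_eq lookup_add lookup_single in_keys_iff when_def)
  then show ?case
    using update by (simp add: const_poly_def mult_single distrib_left distrib_right mult.commute)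
qed (simp add: const_poly_def)

lemma heisenberg_algebra_smult:
  assumes "A \<in> carrier (heisenberg_algebra f)" and "B \<in> carrier (heisenberg_algebra f)"
  shows "(c + d) \<odot>\<^bsub>heisenberg_algebra f\<^esub> A
      = c \<odot>\<^bsub>heisenberg_algebra f\<^esub> A \<oplus>\<^bsub>heisenberg_algebra f\<^esub> d \<odot>\<^bsub>heisenberg_algebra f\<^esub> A"
    and "c \<odot>\<^bsub>heisenberg_algebra f\<^esub> (A \<oplus>\<^bsub>heisenberg_algebra f\<^esub> B)
      = c \<odot>\<^bsub>heisenberg_algebra f\<^esub> A \<oplus>\<^bsub>heisenberg_algebra f\<^esub> c \<odot>\<^bsub>heisenberg_algebra f\<^esub> B"
    and "(c * d) \<odot>\<^bsub>heisenberg_algebra f\<^esub> A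
      = c \<odot>\<^bsub>heisenberg_algebra f\<^esub> (d \<odot>\<^bsub>heisenberg_algebra f\<^esub> A)"
    and "1 \<odot>\<^bsub>heisenberg_algebra f\<^esub> A = A"
    and "(c \<odot>\<^bsub>heisenberg_algebra f\<^esub> A) \<otimes>\<^bsub>heisenberg_algebra f\<^esub> B
      = c \<odot>\<^bsub>heisenberg_algebra f\<^esub> (A \<otimes>\<^bsub>heisenberg_algebra f\<^esub> B)"
    and "A \<otimes>\<^bsub>heisenberg_algebra f\<^esub> (c \<odot>\<^bsub>heisenberg_algebra f\<^esub> B)
      = c \<odot>\<^bsub>heisenberg_algebra f\<^esub> (A \<otimes>\<^bsub>heisenberg_algebra f\<^esub> B)"
proof -
  obtain a b where ab: "A = heisenberg_coset f a" "B = heisenberg_coset f b"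
    using assms by (auto simp: heisenberg_algebra_sel)
  have c: "const_poly (c + d) = const_poly c + const_poly d"
    "const_poly (c * d) = const_poly c * const_poly d" "const_poly 1 = 1"
    by (simp_all add: const_poly_def single_add mult_single)
  have comm: "a * (const_poly c * b) = const_poly c * (a * b)"
    by (metis const_poly_central mult.assoc)
  note simps = ab heisenberg_algebra_sel c
  show "(c + d) \<odot>\<^bsub>heisenberg_algebra f\<^esub> A = c \<odot>\<^bsub>heisenberg_algebra f\<^esub> A \<oplus>\<^bsub>heisenberg_algebra f\<^esub> d \<odot>\<^bsub>heisenberg_algebra f\<^esub> A"
    by (simp add: simps distrib_right)
  show "c \<odot>\<^bsub>heisenberg_algebra f\<^esub> (A \<oplus>\<^bsub>heisenberg_algebra f\<^esub> B) = c \<odot>\<^bsub>heisenberg_algebra f\<^esub> A \<oplus>\<^bsub>heisenberg_algebra f\<^esub> c \<odot>\<^bsub>heisenberg_algebra f\<^esub> B"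
    by (simp add: simps distrib_left)
  show "(c * d) \<odot>\<^bsub>heisenberg_algebra f\<^esub> A = c \<odot>\<^bsub>heisenberg_algebra f\<^esub> (d \<odot>\<^bsub>heisenberg_algebra f\<^esub> A)"
    by (simp add: simps mult.assoc)
  show "1 \<odot>\<^bsub>heisenberg_algebra f\<^esub> A = A"
    by (simp add: simps)
  show "(c \<odot>\<^bsub>heisenberg_algebra f\<^esub> A) \<otimes>\<^bsub>heisenberg_algebra f\<^esub> B = c \<odot>\<^bsub>heisenberg_algebra f\<^esub> (A \<otimes>\<^bsub>heisenberg_algebra f\<^esub> B)"
    by (simp add: simps mult.assoc)
  show "A \<otimes>\<^bsub>heisenberg_algebra f\<^esub> (c \<odot>\<^bsub>heisenberg_algebra f\<^esub> B) = c \<odot>\<^bsub>heisenberg_algebra f\<^esub> (A \<otimes>\<^bsub>heisenberg_algebra f\<^esub> B)"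
    by (simp add: simps comm)
qed

lemma heisenberg_coset_relations:
  defines "x \<equiv> gen_poly GenX" and "y \<equiv> gen_poly GenY" and "h \<equiv> gen_poly GenH"
  shows "heisenberg_coset f (h * x) = heisenberg_coset f (x * eval_at f h)"
    and "heisenberg_coset f (y * h) = heisenberg_coset f (eval_at f h * y)"
    and "heisenberg_coset f (y * x - x * y) = heisenberg_coset f (eval_at f h - h)"
proof -
  interpret I: ideal "heisenberg_ideal f" free_algebra by (rule ideal_heisenberg_ideal)
  have eq: "heisenberg_coset f a = heisenberg_coset f b" if "a - b \<in> heisenberg_relations f" for a b
  proof -
    have "a - b \<in> heisenberg_ideal f"
      using that ring.genideal_self[OF ring_free_algebra, of "heisenberg_relations f"]
      by (auto simp: heisenberg_ideal_def free_algebra_def)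
    hence "(a - b) + b \<in> heisenberg_coset f b"
      unfolding heisenberg_coset_def a_r_coset_def'
      by (auto simp: free_algebra_def intro!: bexI[of _ "a - b"])
    hence "a \<in> heisenberg_coset f b" by simp
    thus ?thesis
      using I.a_repr_independence[OF _ _ I.a_subgroup, of a b] by (simp add: heisenberg_coset_def free_algebra_def)
  qed
  show "heisenberg_coset f (h * x) = heisenberg_coset f (x * eval_at f h)"
    "heisenberg_coset f (y * h) = heisenberg_coset f (eval_at f h * y)"
    "heisenberg_coset f (y * x - x * y) = heisenberg_coset f (eval_at f h - h)"
    by (rule eq, simp add: heisenberg_relations_def Let_def x_def y_def h_def)+
qed

end

(*
A locally nilpotent derivation of a domain of characteristic 0 defines a degree function which is
additive on products. In h x = x f(h) the two sides have degrees deg h + deg x and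
deg x + (deg f) (deg h), so deg h = 0, that is, h is a constant. Applying the derivation D to
h x = x f(h) then gives h (D x) = (D x) f(h), which forces D x to be a right multiple of x; as a
nonzero D x would have smaller degree than x, it vanishes. Likewise for y.

That the algebra is a domain and the shape of D x are read off the normal forms x^i p(h) y^k, whose
linear independence comes from an explicit representation of the free algebra on them.
*)

theory Submission
  imports Defs
begin

section \<open>The degree of a locally nilpotent derivation\<close>

text \<open>In a quotient of the free algebra nothing says directly when an element is nonzero. The
  representation removes this obstacle: the generators act on normal forms by the formulas that left
  multiplication must obey, the relations are checked there once, and \<open>lift m\<close> sends 1
  back to \<open>m\<close>, so distinct normal forms stay distinct in the quotient. The derivation
  is carried over to normal forms, where products are compared coefficient by coefficient. Absence
  of zero divisors is seen on leading coefficients, first in x and then in y. There the only twist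
  is the substitution of iterates of f, which is injective on polynomials since f is not constant.
  The same twist yields the multiples of x and y. On the terms without x, the equation h m = m f(h)
  multiplies the coefficient of y^k by h on one side and by the (k+1)-st iterate of f on the other.
  These differ because deg f > 1, so m has no term without x.\<close>

text \<open>Neither associativity nor a unit is needed here.\<close>

locale locally_nilpotent_derivation = vector_space scale
  for scale :: "'k::field_char_0 \<Rightarrow> 'a::ab_group_add \<Rightarrow> 'a" +
  fixes mul :: "'a \<Rightarrow> 'a \<Rightarrow> 'a" (infixl "\<star>" 70) and D :: "'a \<Rightarrow> 'a"
  assumes mul_add_left: "(a + b) \<star> c = a \<star> c + b \<star> c"
    and mul_add_right: "a \<star> (b + c) = a \<star> b + a \<star> c"
    and mul_eq_0D: "a \<star> b = 0 \<Longrightarrow> a = 0 \<or> b = 0"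
    and D_add: "D (a + b) = D a + D b"
    and D_scale: "D (scale t a) = scale t (D a)"
    and D_mul: "D (a \<star> b) = D a \<star> b + a \<star> D b"
    and nilpotent: "\<exists>k. (D ^^ k) a = 0"
begin

lemma mul_0_left [simp]: "0 \<star> a = 0"
  using mul_add_left[of 0 0 a] by simp

lemma mul_0_right [simp]: "a \<star> 0 = 0"
  using mul_add_right[of a 0 0] by simp

lemma D_0 [simp]: "D 0 = 0"
  using D_add[of 0 0] by simp

lemma Dpow_0 [simp]: "(D ^^ k) 0 = 0"
  by (induction k) auto

lemma Dpow_add: "(D ^^ k) (a + b) = (D ^^ k) a + (D ^^ k) b"
  by (induction k) (auto simp: D_add)

lemma Dpow_scale: "(D ^^ k) (scale c a) = scale c ((D ^^ k) a)"
  by (induction k) (auto simp: D_scale)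

lemma Dpow_sum: "(D ^^ k) (sum g A) = (\<Sum>i\<in>A. (D ^^ k) (g i))"
  by (induction A rule: infinite_finite_induct) (auto simp: Dpow_add)

lemma Dpow_D: "(D ^^ k) (D a) = (D ^^ Suc k) a"
  by (simp add: funpow_swap1)

lemma Dpow_eq_0_mono:
  assumes "(D ^^ p) a = 0" and "p \<le> r"
  shows "(D ^^ r) a = 0"
proof -
  have "(D ^^ (r - p + p)) a = (D ^^ (r - p)) ((D ^^ p) a)"
    by (simp only: funpow_add comp_apply)
  with assms show ?thesis by simp
qed

text \<open>By the Leibniz rule \<open>D^r (a b)\<close> is a sum of multiples of
  \<open>D^i a\<close> times \<open>D^j b\<close> with \<open>i + j = r\<close>, and
  \<open>p + q \<le> r + 1\<close> forces \<open>i \<ge> p\<close> or \<open>j \<ge> q\<close>. The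
  induction peels off one D at a time instead of expanding.\<close>

lemma Dpow_mul_eq_0:
  assumes "(D ^^ p) a = 0" and "(D ^^ q) b = 0" and "p + q \<le> Suc r"
  shows "(D ^^ r) (a \<star> b) = 0"
  using assms
proof (induction r arbitrary: a b p q)
  case 0
  hence "p = 0 \<or> q = 0" by auto
  with 0 show ?case by auto
next
  case (Suc r)
  have "(D ^^ r) (D a \<star> b) = 0"
  proof (cases p)
    case 0
    with Suc.prems show ?thesis by simp
  next
    case (Suc p')
    show ?thesis
      by (rule Suc.IH[of p' _ q]) (use Suc Suc.prems in \<open>auto simp: Dpow_D\<close>)
  qed
  moreover have "(D ^^ r) (a \<star> D b) = 0"
  proof (cases q)
    case 0
    with Suc.prems show ?thesis by simp
  next
    case (Suc q')
    show ?thesis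
      by (rule Suc.IH[of p _ q']) (use Suc Suc.prems in \<open>auto simp: Dpow_D\<close>)
  qed
  ultimately show ?case
    by (simp add: Dpow_D[symmetric] D_mul Dpow_add del: funpow.simps)
qed

text \<open>The factor \<open>N\<close> is the binomial coefficient \<open>p + q choose p\<close>; only \<open>N > 0\<close> matters.\<close>

lemma Dpow_mul_top:
  assumes "(D ^^ Suc p) a = 0" and "(D ^^ Suc q) b = 0"
  shows "\<exists>N>0. (D ^^ (p + q)) (a \<star> b) = scale (of_nat N) ((D ^^ p) a \<star> (D ^^ q) b)"
  using assms
proof (induction "p + q" arbitrary: a b p q)
  case 0
  thus ?case by (intro exI[of _ 1]) auto
next
  case (Suc n)
  have step: "(D ^^ Suc n) (a \<star> b) = (D ^^ n) (D a \<star> b) + (D ^^ n) (a \<star> D b)"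
    by (simp add: Dpow_D[symmetric] D_mul Dpow_add del: funpow.simps)
  have left: "\<exists>N>0. (D ^^ n) (D a \<star> b) = scale (of_nat N) ((D ^^ p) a \<star> (D ^^ q) b)"
    if "p = Suc p'" for p'
    using Suc.hyps(1)[of p' q "D a" b] Suc.hyps(2) Suc.prems that
    by (simp add: Dpow_D del: funpow.simps)
  have right: "\<exists>N>0. (D ^^ n) (a \<star> D b) = scale (of_nat N) ((D ^^ p) a \<star> (D ^^ q) b)"
    if "q = Suc q'" for q'
    using Suc.hyps(1)[of p q' a "D b"] Suc.hyps(2) Suc.prems that
    by (simp add: Dpow_D del: funpow.simps)
  consider "p = 0" "q = Suc n" | p' where "p = Suc p'" "q = 0" | p' q' where "p = Suc p'" "q = Suc q'"
    using Suc.hyps(2) by (cases p; cases q) auto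
  thus ?case
  proof cases
    case 1
    with Suc.prems have "D a = 0" by simp
    with right[OF 1(2)] step Suc.hyps(2) show ?thesis by simp
  next
    case 2
    with Suc.prems have "D b = 0" by simp
    with left[OF 2(1)] step Suc.hyps(2) show ?thesis by simp
  next
    case 3
    obtain N N' where "N > 0" "N' > 0"
      "(D ^^ n) (D a \<star> b) = scale (of_nat N) ((D ^^ p) a \<star> (D ^^ q) b)"
      "(D ^^ n) (a \<star> D b) = scale (of_nat N') ((D ^^ p) a \<star> (D ^^ q) b)"
      using left[OF 3(1)] right[OF 3(2)] by blast
    \<comment> \<open>Both halves of the Leibniz rule end in the same product, so the factors add as
      in Pascal's rule.\<close>
    hence "(D ^^ (p + q)) (a \<star> b) = scale (of_nat (N + N')) ((D ^^ p) a \<star> (D ^^ q) b)"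
      using step by (simp add: Suc.hyps(2)[symmetric] scale_left_distrib del: funpow.simps)
    with \<open>N > 0\<close> show ?thesis by (intro exI[of _ "N + N'"]) auto
  qed
qed

text \<open>A relation rather than a function, because 0 has no degree.\<close>

definition has_degree :: "'a \<Rightarrow> nat \<Rightarrow> bool" where
  "has_degree a d \<longleftrightarrow> (D ^^ d) a \<noteq> 0 \<and> (D ^^ Suc d) a = 0"

lemma has_degree_exists:
  assumes "a \<noteq> 0"
  obtains d where "has_degree a d"
proof -
  define k where "k = (LEAST k. (D ^^ k) a = 0)"
  have k: "(D ^^ k) a = 0"
    unfolding k_def using nilpotent[of a] by (rule LeastI_ex)
  with assms obtain d where d: "k = Suc d" by (cases k) auto
  have "(D ^^ d) a \<noteq> 0"
    using not_less_Least[of d "\<lambda>k. (D ^^ k) a = 0"] d by (auto simp: k_def)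
  with k d that show ?thesis by (simp add: has_degree_def)
qed

lemma has_degree_unique:
  assumes "has_degree a d" and "has_degree a e"
  shows "d = e"
  using assms Dpow_eq_0_mono[of "Suc d" a e] Dpow_eq_0_mono[of "Suc e" a d]
  unfolding has_degree_def by (metis Suc_leI linorder_neqE_nat)

lemma has_degree_mul:
  assumes "has_degree a p" and "has_degree b q"
  shows "has_degree (a \<star> b) (p + q)"
proof -
  obtain N where "N > 0" "(D ^^ (p + q)) (a \<star> b) = scale (of_nat N) ((D ^^ p) a \<star> (D ^^ q) b)"
    using Dpow_mul_top[of p a q b] assms by (auto simp: has_degree_def)
  moreover have "(D ^^ p) a \<star> (D ^^ q) b \<noteq> 0"
    using assms mul_eq_0D by (auto simp: has_degree_def)
  moreover have "(D ^^ Suc (p + q)) (a \<star> b) = 0"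
    using assms by (intro Dpow_mul_eq_0[of "Suc p" _ "Suc q"]) (auto simp: has_degree_def)
  \<comment> \<open>Characteristic 0 enters here: the positive integer \<open>N\<close> is a nonzero
    scalar.\<close>
  ultimately show ?thesis by (simp add: has_degree_def)
qed

lemma has_degree_D:
  assumes "has_degree a d" and "D a \<noteq> 0"
  shows "\<exists>e. d = Suc e \<and> has_degree (D a) e"
  using assms by (cases d) (auto simp: has_degree_def funpow_swap1)

text \<open>A nonzero value \<open>D a\<close> has smaller degree than \<open>a\<close>, but a multiple of \<open>a\<close> has not.\<close>

lemma D_eq_mul_left_imp_0:
  assumes "D a = a \<star> b"
  shows "D a = 0"
proof (rule ccontr)
  assume "D a \<noteq> 0"
  hence "a \<noteq> 0" "b \<noteq> 0" using assms by auto
  then obtain d e where a: "has_degree a d" and b: "has_degree b e"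
    by (metis has_degree_exists)
  obtain d' where "d = Suc d'" "has_degree (D a) d'"
    using has_degree_D[OF a \<open>D a \<noteq> 0\<close>] by blast
  moreover have "has_degree (D a) (d + e)"
    unfolding assms by (rule has_degree_mul) fact+
  ultimately have "d' = d + e" by (metis has_degree_unique)
  with \<open>d = Suc d'\<close> show False by simp
qed

lemma D_eq_mul_right_imp_0:
  assumes "D a = b \<star> a"
  shows "D a = 0"
proof (rule ccontr)
  assume "D a \<noteq> 0"
  hence "a \<noteq> 0" "b \<noteq> 0" using assms by auto
  then obtain d e where a: "has_degree a d" and b: "has_degree b e"
    by (metis has_degree_exists)
  obtain d' where "d = Suc d'" "has_degree (D a) d'"
    using has_degree_D[OF a \<open>D a \<noteq> 0\<close>] by blast
  moreover have "has_degree (D a) (e + d)"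
    unfolding assms by (rule has_degree_mul) fact+
  ultimately have "d' = e + d" by (metis has_degree_unique)
  with \<open>d = Suc d'\<close> show False by simp
qed

text \<open>For \<open>d > 0\<close> the degrees are distinct, so the top term cannot cancel:
  \<open>D^(n d)\<close> already kills the lower ones. Applied to the powers of h, this gives the
  degree of f(h).\<close>

lemma has_degree_linear_combination:
  assumes "\<And>i. i \<le> n \<Longrightarrow> has_degree (g i) (i * d)" and "d > 0" and "c n \<noteq> 0"
  shows "has_degree (\<Sum>i\<le>n. scale (c i) (g i)) (n * d)"
proof -
  have 0: "(D ^^ r) (g i) = 0" if "i \<le> n" "i * d < r" for i r
    using Dpow_eq_0_mono[of "Suc (i * d)" "g i" r] assms(1)[OF that(1)] that
    by (auto simp: has_degree_def)
  have "(D ^^ (n * d)) (\<Sum>i\<le>n. scale (c i) (g i)) = (\<Sum>i\<le>n. scale (c i) ((D ^^ (n * d)) (g i)))"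
    by (simp add: Dpow_sum Dpow_scale)
  also have "\<dots> = (\<Sum>i\<in>{n}. scale (c i) ((D ^^ (n * d)) (g i)))"
    using 0 \<open>d > 0\<close> by (intro sum.mono_neutral_right) auto
  also have "\<dots> \<noteq> 0"
    using assms(1)[of n] assms(3) by (simp add: has_degree_def)
  moreover have "(D ^^ Suc (n * d)) (\<Sum>i\<le>n. scale (c i) (g i)) = 0"
    unfolding Dpow_sum Dpow_scale using 0 \<open>d > 0\<close>
    by (intro sum.neutral) (auto simp del: funpow.simps simp: less_Suc_eq_le)
  ultimately show ?thesis by (simp add: has_degree_def)
qed

end

section \<open>Additive functions of the coefficients of a polynomial\<close>

lemma poly_monom_induct [case_names zero monom add]:
  assumes "P 0" and "\<And>c n. P (monom c n)" and "\<And>p q. P p \<Longrightarrow> P q \<Longrightarrow> P (p + q)"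
  shows "P p"
proof -
  have "P (\<Sum>i\<in>A. monom (coeff p i) i)" if "finite A" for A
    using that assms by (induction A) auto
  thus ?thesis
    using poly_as_sum_of_monoms[of p] by (metis finite_atMost)
qed

text \<open>Evaluation, the operators on normal forms and the lift are all built from such sums with
  \<open>g i\<close> additive, so additivity and the value on monomials are settled once for all of
  them.\<close>

definition coeff_sum :: "(nat \<Rightarrow> 'a::zero \<Rightarrow> 'b::comm_monoid_add) \<Rightarrow> 'a poly \<Rightarrow> 'b" where
  "coeff_sum g p = (\<Sum>i\<le>degree p. g i (coeff p i))"

lemma coeff_sum_0:
  assumes "\<And>i. g i 0 = 0"
  shows "coeff_sum g 0 = 0"
  using assms by (simp add: coeff_sum_def)

lemma coeff_sum_bound:
  assumes "\<And>i. g i 0 = 0" and "degree p \<le> n"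
  shows "coeff_sum g p = (\<Sum>i\<le>n. g i (coeff p i))"
  unfolding coeff_sum_def
  by (rule sum.mono_neutral_left) (use assms in \<open>auto simp: coeff_eq_0\<close>)

lemma coeff_sum_monom:
  assumes "\<And>i. g i 0 = 0"
  shows "coeff_sum g (monom c n) = g n c"
proof -
  have "coeff_sum g (monom c n) = (\<Sum>i\<le>n. g i (coeff (monom c n) i))"
    by (rule coeff_sum_bound) (use assms degree_monom_le in auto)
  also have "\<dots> = (\<Sum>i\<in>{n}. g i (coeff (monom c n) i))"
    by (rule sum.mono_neutral_right) (use assms in auto)
  finally show ?thesis by simp
qed

lemma coeff_sum_add:
  fixes g :: "nat \<Rightarrow> 'a::comm_monoid_add \<Rightarrow> 'b::comm_monoid_add"
  assumes "\<And>i. g i 0 = 0" and "\<And>i a b. g i (a + b) = g i a + g i b"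
  shows "coeff_sum g (p + q) = coeff_sum g p + coeff_sum g q"
proof -
  define n where "n = max (degree p) (degree q)"
  have "degree (p + q) \<le> n" "degree p \<le> n" "degree q \<le> n"
    by (auto simp: n_def degree_add_le_max)
  thus ?thesis
    using assms by (simp add: coeff_sum_bound[of g _ n] sum.distrib)
qed

lemma coeff_coeff_sum_monom:
  assumes "\<And>i. g i 0 = 0"
  shows "coeff (coeff_sum (\<lambda>i c. monom (g i c) i) p) n = g n (coeff p n)"
proof -
  have "coeff (coeff_sum (\<lambda>i c. monom (g i c) i) p) n =
      (\<Sum>i\<le>max n (degree p). if i = n then g i (coeff p i) else 0)"
    using assms by (subst coeff_sum_bound[of _ p "max n (degree p)"]) (auto simp: coeff_sum)
  thus ?thesis by simp
qed

section \<open>Evaluation in the free algebra\<close>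

lemma free_poly_induct [case_names zero single add]:
  fixes a :: free_poly
  assumes "P 0" and "\<And>w c. P (Poly_Mapping.single w c)" and "\<And>a b. P a \<Longrightarrow> P b \<Longrightarrow> P (a + b)"
  shows "P a"
proof (induction a rule: update_induct)
  case (update a k v)
  have "Poly_Mapping.update k v a = a + Poly_Mapping.single k v"
    using update by (intro poly_mapping_eqI)
      (auto simp: update.rep_eq lookup_add lookup_single in_keys_iff when_def)
  with update assms show ?case by simp
qed (rule assms(1))

lemma const_poly_0 [simp]: "const_poly 0 = 0"
  and const_poly_1 [simp]: "const_poly 1 = 1"
  and const_poly_add: "const_poly (c + d) = const_poly c + const_poly d"
  and const_poly_mult: "const_poly (c * d) = const_poly c * const_poly d"
  by (simp_all add: const_poly_def single_add mult_single)

lemma eval_at_coeff_sum: "eval_at p a = coeff_sum (\<lambda>i c. const_poly c * a ^ i) p"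
  by (simp add: eval_at_def coeff_sum_def)

lemma eval_at_0 [simp]: "eval_at 0 a = 0"
  by (simp add: eval_at_def)

lemma eval_at_monom: "eval_at (monom c n) a = const_poly c * a ^ n"
  unfolding eval_at_coeff_sum by (subst coeff_sum_monom) auto

lemma eval_at_add: "eval_at (p + q) a = eval_at p a + eval_at q a"
  unfolding eval_at_coeff_sum
  by (rule coeff_sum_add) (auto simp: const_poly_add distrib_right)

lemma eval_at_diff: "eval_at (p - q) a = eval_at p a - eval_at q a"
  using eval_at_add[of "p - q" q a] by (simp add: algebra_simps)

lemma eval_at_const: "eval_at [:c:] a = const_poly c"
  using eval_at_monom[of c 0 a] by (simp add: monom_0)

lemma eval_at_1 [simp]: "eval_at 1 a = 1"
  using eval_at_const[of 1 a] by (simp add: one_pCons)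

lemma eval_at_var: "eval_at [:0, 1:] a = a"
  using eval_at_monom[of 1 1 a] by (simp add: monom_altdef)

lemma eval_at_mult: "eval_at (p * q) a = eval_at p a * eval_at q a"
proof (induction p rule: poly_monom_induct)
  case (monom c n)
  show ?case
  proof (induction q rule: poly_monom_induct)
    case (monom d m)
    have "const_poly (c * d) * a ^ (n + m) = const_poly c * (const_poly d * a ^ n) * a ^ m"
      by (simp add: const_poly_mult power_add mult.assoc)
    also have "\<dots> = const_poly c * a ^ n * (const_poly d * a ^ m)"
      by (simp add: const_poly_central[of d "a ^ n"] mult.assoc)
    finally show ?case by (simp add: mult_monom eval_at_monom)
  qed (simp_all add: eval_at_add distrib_left)
qed (simp_all add: eval_at_add distrib_right)

lemma eval_at_power: "eval_at (p ^ n) a = eval_at p a ^ n"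
  by (induction n) (simp_all add: eval_at_mult)

lemma pcompose_monom: "pcompose (monom c n) q = smult c (q ^ n)"
  for q :: "'a::comm_semiring_1 poly"
  by (induction n) (simp_all add: monom_0 monom_Suc pcompose_pCons)

lemma eval_at_pcompose: "eval_at (pcompose p q) a = eval_at p (eval_at q a)"
proof (induction p rule: poly_monom_induct)
  case (monom c n)
  have "eval_at (smult c (q ^ n)) a = eval_at ([:c:] * q ^ n) a" by simp
  also have "\<dots> = const_poly c * eval_at q a ^ n"
    by (simp only: eval_at_mult eval_at_const eval_at_power)
  finally show ?case by (simp add: pcompose_monom eval_at_monom)
qed (simp_all add: pcompose_add eval_at_add)

section \<open>A representation on normal forms\<close>

text \<open>The normal form \<open>\<Sum> x\<^sup>i p\<^sub>i\<^sub>k(h) y\<^sup>k\<close> is represented by the polynomial in an outer variable \<open>x\<close> and a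
  middle variable \<open>y\<close> whose coefficients are the polynomials \<open>p\<^sub>i\<^sub>k\<close>.\<close>

type_synonym normal_form = "complex poly poly poly"

abbreviation nf_monom :: "nat \<Rightarrow> complex poly \<Rightarrow> nat \<Rightarrow> normal_form" where
  "nf_monom i p k \<equiv> monom (monom p k) i"

abbreviation nf_scale :: "complex \<Rightarrow> normal_form \<Rightarrow> normal_form" where
  "nf_scale c \<equiv> smult [:[:c:]:]"

lemma nf_monom_1 [simp]: "nf_monom 0 1 0 = 1"
  by (simp add: monom_0 one_pCons)

lemma normal_form_induct [case_names zero monom add]:
  fixes m :: normal_form
  assumes "P 0" and "\<And>i p k. P (nf_monom i p k)" and "\<And>m n. P m \<Longrightarrow> P n \<Longrightarrow> P (m + n)"
  shows "P m"
proof (induction m rule: poly_monom_induct)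
  case (monom b i)
  show ?case
    by (induction b rule: poly_monom_induct) (use assms in \<open>auto simp: add_monom[symmetric]\<close>)
qed (use assms in auto)

locale heisenberg =
  fixes f :: "complex poly"
begin

primrec iterate :: "nat \<Rightarrow> complex poly" where
  "iterate 0 = [:0, 1:]"
| "iterate (Suc i) = pcompose f (iterate i)"

text \<open>Moving p(h) across x or y substitutes f on the inside, whereas the recursion composes on
  the outside; f commutes with its iterates.\<close>

lemma iterate_Suc': "iterate (Suc i) = pcompose (iterate i) f"
proof (induction i)
  case (Suc i)
  have "iterate (Suc (Suc i)) = pcompose f (iterate (Suc i))" by simp
  also have "\<dots> = pcompose (pcompose f (iterate i)) f"
    unfolding Suc.IH by (rule pcompose_assoc)
  finally show ?case by simp
qed (simp add: pcompose_pCons)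

text \<open>The relation \<open>y p(h) = p(f(h)) y\<close> as an operator on polynomials in \<open>h\<close> and \<open>y\<close>.\<close>

definition y_shift :: "complex poly poly \<Rightarrow> complex poly poly" where
  "y_shift b = pCons 0 (map_poly (\<lambda>p. pcompose p f) b)"

lemma coeff_y_shift:
  "coeff (y_shift b) k = (if k = 0 then 0 else pcompose (coeff b (k - 1)) f)"
  by (auto simp: y_shift_def coeff_pCons coeff_map_poly split: nat.split)

lemma y_shift_0 [simp]: "y_shift 0 = 0"
  by (simp add: y_shift_def)

lemma y_shift_add: "y_shift (b + c) = y_shift b + y_shift c"
  by (rule poly_eqI) (simp add: coeff_y_shift pcompose_add)

lemma y_shift_smult: "y_shift (smult p b) = smult (pcompose p f) (y_shift b)"
  by (rule poly_eqI) (simp add: coeff_y_shift pcompose_mult)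

lemma y_shift_monom: "y_shift (monom p k) = monom (pcompose p f) (Suc k)"
  by (rule poly_eqI) (auto simp: coeff_y_shift)

text \<open>Row i stands to the right of x^i, and \<open>h x^i = x^i f^i(h)\<close>, so h reaches
  row i as \<open>iterate i\<close>.\<close>

definition h_mult :: "normal_form \<Rightarrow> normal_form" where
  "h_mult = coeff_sum (\<lambda>i b. monom (smult (iterate i) b) i)"

text \<open>The second summand comes from \<open>y x\<^sup>i = x\<^sup>i y + x\<^sup>i\<^sup>-\<^sup>1 (f\<^sup>i(h) - h)\<close>, where \<open>f\<^sup>i\<close> is the iterate of \<open>f\<close>.\<close>

definition y_mult :: "normal_form \<Rightarrow> normal_form" where
  "y_mult m = coeff_sum (\<lambda>i b. monom (y_shift b) i) m +
    poly_shift 1 (coeff_sum (\<lambda>i b. monom (smult (iterate i - [:0, 1:]) b) i) m)"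

lemma coeff_h_mult: "coeff (h_mult m) i = smult (iterate i) (coeff m i)"
  by (simp add: h_mult_def coeff_coeff_sum_monom)

text \<open>The shift drops row 0 of the second sum without loss: \<open>iterate 0\<close> is the
  variable, so that row vanishes.\<close>

lemma coeff_y_mult:
  "coeff (y_mult m) i = y_shift (coeff m i) + smult (iterate (Suc i) - [:0, 1:]) (coeff m (Suc i))"
  by (simp add: y_mult_def coeff_coeff_sum_monom coeff_poly_shift)

fun gen_act :: "gen \<Rightarrow> normal_form \<Rightarrow> normal_form" where
  "gen_act GenX m = pCons 0 m"
| "gen_act GenH m = h_mult m"
| "gen_act GenY m = y_mult m"

lemma gen_act_add: "gen_act g (m + n) = gen_act g m + gen_act g n"
  by (cases g)
    (auto intro!: poly_eqI simp: coeff_h_mult coeff_y_mult y_shift_add smult_add_right coeff_pCons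
      split: nat.split)

lemma gen_act_scale: "gen_act g (nf_scale c m) = nf_scale c (gen_act g m)"
  by (cases g)
    (auto intro!: poly_eqI simp: coeff_h_mult coeff_y_mult coeff_y_shift coeff_pCons pcompose_smult
      algebra_simps split: nat.split)

definition word_act :: "gen list \<Rightarrow> normal_form \<Rightarrow> normal_form" where
  "word_act w = foldr gen_act w"

lemma word_act_Nil [simp]: "word_act [] m = m"
  and word_act_Cons [simp]: "word_act (g # w) m = gen_act g (word_act w m)"
  and word_act_append: "word_act (v @ w) m = word_act v (word_act w m)"
  by (simp_all add: word_act_def)

lemma word_act_add: "word_act w (m + n) = word_act w m + word_act w n"
  by (induction w) (simp_all add: gen_act_add)

lemma word_act_scale: "word_act w (nf_scale c m) = nf_scale c (word_act w m)"
  by (induction w) (simp_all add: gen_act_scale)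

definition act :: "free_poly \<Rightarrow> normal_form \<Rightarrow> normal_form" where
  "act a m = (\<Sum>w\<in>Poly_Mapping.keys a. nf_scale (Poly_Mapping.lookup a w) (word_act (letters w) m))"

lemma nf_scale_add_left: "nf_scale (c + d) m = nf_scale c m + nf_scale d m"
  using smult_add_left[of "[:[:c:]:]" "[:[:d:]:]" m] by simp

lemma act_0 [simp]: "act 0 m = 0"
  by (simp add: act_def)

lemma act_single: "act (Poly_Mapping.single w c) m = nf_scale c (word_act (letters w) m)"
  by (cases "c = 0") (simp_all add: act_def)

lemma act_add_left: "act (a + b) m = act a m + act b m"
  unfolding act_def
  by (rule setsum_keys_plus_distrib) (simp_all add: nf_scale_add_left)

lemma act_minus_left: "act (- a) m = - act a m"
  using act_add_left[of a "- a" m] by (simp add: eq_neg_iff_add_eq_0 add.commute)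

lemma act_diff_left: "act (a - b) m = act a m - act b m"
  using act_add_left[of a "- b" m] by (simp add: act_minus_left)

lemma act_add: "act a (m + n) = act a m + act a n"
  by (induction a rule: free_poly_induct)
    (simp_all add: act_single act_add_left word_act_add smult_add_right)

lemma act_0_right [simp]: "act a 0 = 0"
  using act_add[of a 0 0] by simp

lemma act_sum_left: "act (sum g A) m = (\<Sum>i\<in>A. act (g i) m)"
  by (induction A rule: infinite_finite_induct) (simp_all add: act_add_left)

lemma act_mult: "act (a * b) m = act a (act b m)"
proof (induction a rule: free_poly_induct)
  case (single v c)
  show ?case
    by (induction b rule: free_poly_induct)
      (simp_all add: act_single act_add_left act_add mult_single plus_word_def word_act_append
        distrib_left word_act_scale)
qed (simp_all add: act_add_left distrib_right)

lemma act_const: "act (const_poly c) m = nf_scale c m"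
  by (simp add: const_poly_def act_single zero_word_def)

lemma act_1 [simp]: "act 1 m = m"
  using act_const[of 1 m] by (simp flip: one_pCons)

lemma act_gen: "act (gen_poly g) m = gen_act g m"
  by (simp add: gen_poly_def act_single flip: one_pCons)

lemma act_gen_power: "act (gen_poly g ^ n) m = (gen_act g ^^ n) m"
  by (induction n arbitrary: m) (simp_all add: act_mult act_gen)

lemma coeff_h_mult_power: "coeff ((h_mult ^^ n) m) i = smult (iterate i ^ n) (coeff m i)"
  by (induction n) (simp_all add: coeff_h_mult)

lemma coeff_act_eval_h:
  "coeff (act (eval_at p (gen_poly GenH)) m) i = smult (pcompose p (iterate i)) (coeff m i)"
proof (induction p rule: poly_monom_induct)
  case (monom c n)
  have "gen_act GenH = h_mult" by auto
  thus ?case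
    by (simp add: eval_at_monom act_mult act_const act_gen_power coeff_h_mult_power pcompose_monom)
qed (simp_all add: eval_at_add act_add_left pcompose_add smult_add_left)

text \<open>All three relations hold row by row. In the last one the \<open>y_shift\<close> terms
  cancel, and the differences of iterates with h telescope to
  \<open>iterate (Suc i) - iterate i\<close>, which is how f(h) - h acts on row i.\<close>

lemma act_relation:
  assumes "r \<in> heisenberg_relations f"
  shows "act r m = 0"
proof -
  define x y h where xyh: "x = gen_poly GenX" "y = gen_poly GenY" "h = gen_poly GenH"
  have h: "coeff (act (eval_at f h) m) i = smult (iterate (Suc i)) (coeff m i)" for m i
    by (simp add: xyh coeff_act_eval_h)
  have "act (h * x) m = act (x * eval_at f h) m"
    by (rule poly_eqI) (auto simp: act_mult act_gen xyh coeff_h_mult coeff_pCons h[unfolded xyh]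
      split: nat.split)
  moreover have "act (y * h) m = act (eval_at f h * y) m"
    by (rule poly_eqI)
      (simp add: act_mult act_gen xyh coeff_h_mult coeff_y_mult h[unfolded xyh] y_shift_smult
        iterate_Suc' smult_add_right mult.commute del: iterate.simps)
  moreover have "act (y * x - x * y) m = act (eval_at f h - h) m"
    by (rule poly_eqI)
      (auto simp: act_mult act_gen act_diff_left xyh coeff_h_mult coeff_y_mult h[unfolded xyh]
        coeff_pCons smult_diff_left simp flip: iterate.simps(2) split: nat.split)
  ultimately show ?thesis
    using assms by (auto simp: heisenberg_relations_def Let_def act_diff_left xyh)
qed

lemma act_heisenberg_ideal:
  assumes "a \<in> heisenberg_ideal f"
  shows "act a m = 0"
proof -
  \<comment> \<open>Quantifying over all \<open>m\<close> makes the annihilator two-sided: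
    \<open>a * b\<close> acts on \<open>m\<close> as \<open>a\<close> acts on the vector
    \<open>act b m\<close>.\<close>
  have "ideal {a. \<forall>m. act a m = 0} free_algebra"
  proof (rule idealI)
    show "ring free_algebra" by (rule ring_free_algebra)
    interpret ring free_algebra by (rule ring_free_algebra)
    show "subgroup {a. \<forall>m. act a m = 0} (add_monoid free_algebra)"
    proof (rule group.subgroupI)
      show "group (add_monoid free_algebra)" by (rule a_group)
      fix a assume a: "a \<in> {a. \<forall>m. act a m = 0}"
      have "inv\<^bsub>add_monoid free_algebra\<^esub> a = - a"
        by (rule group.inv_equality[OF a_group]) (auto simp: free_algebra_def)
      with a show "inv\<^bsub>add_monoid free_algebra\<^esub> a \<in> {a. \<forall>m. act a m = 0}"
        by (simp add: act_minus_left)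
    qed (auto simp: free_algebra_def act_add_left intro!: exI[of _ 0])
  qed (auto simp: free_algebra_def act_mult)
  hence "heisenberg_ideal f \<subseteq> {a. \<forall>m. act a m = 0}"
    unfolding heisenberg_ideal_def
    by (rule ring.genideal_minimal[OF ring_free_algebra]) (auto simp: act_relation)
  with assms show ?thesis by auto
qed

end

section \<open>Normal forms represent the elements of the algebra\<close>

context heisenberg
begin

abbreviation "gx \<equiv> gen_poly GenX"
abbreviation "gy \<equiv> gen_poly GenY"
abbreviation "gh \<equiv> gen_poly GenH"

text \<open>Equality in the quotient, phrased on representatives so that ring identities of the free
  algebra stay available.\<close>

definition cong :: "free_poly \<Rightarrow> free_poly \<Rightarrow> bool" (infix "\<approx>" 50) where
  "a \<approx> b \<longleftrightarrow> heisenberg_coset f a = heisenberg_coset f b"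

lemma cong_refl [simp, intro]: "a \<approx> a"
  and cong_sym: "a \<approx> b \<Longrightarrow> b \<approx> a"
  and cong_trans [trans]: "a \<approx> b \<Longrightarrow> b \<approx> c \<Longrightarrow> a \<approx> c"
  by (simp_all add: cong_def)

lemma cong_mult: "a \<approx> a' \<Longrightarrow> b \<approx> b' \<Longrightarrow> a * b \<approx> a' * b'"
  unfolding cong_def by (metis heisenberg_algebra_sel(4))

lemma cong_add: "a \<approx> a' \<Longrightarrow> b \<approx> b' \<Longrightarrow> a + b \<approx> a' + b'"
  unfolding cong_def by (metis heisenberg_algebra_sel(5))

lemma cong_imp_act_eq:
  assumes "a \<approx> b"
  shows "act a m = act b m"
proof -
  interpret I: ideal "heisenberg_ideal f" free_algebra by (rule ideal_heisenberg_ideal)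
  have "a \<in> heisenberg_coset f a"
    unfolding heisenberg_coset_def by (rule I.a_rcos_self) (simp add: free_algebra_def)
  hence "a \<in> heisenberg_coset f b"
    using assms by (simp add: cong_def)
  then obtain i where "i \<in> heisenberg_ideal f" "a = i + b"
    by (auto simp: heisenberg_coset_def a_r_coset_def' free_algebra_def)
  thus ?thesis by (simp add: act_add_left act_heisenberg_ideal)
qed

lemma cong_h_x: "gh * gx \<approx> gx * eval_at f gh"
  and cong_y_h: "gy * gh \<approx> eval_at f gh * gy"
  by (simp_all add: cong_def heisenberg_coset_relations)

lemma cong_y_x: "gy * gx \<approx> gx * gy + (eval_at f gh - gh)"
proof -
  have "(gy * gx - gx * gy) + gx * gy \<approx> (eval_at f gh - gh) + gx * gy"
    by (intro cong_add) (simp_all add: cong_def heisenberg_coset_relations)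
  thus ?thesis by (simp add: add.commute)
qed

lemma cong_eval_at_left:
  assumes "a * z \<approx> z * b"
  shows "eval_at p a * z \<approx> z * eval_at p b"
proof (induction p rule: poly_monom_induct)
  case (monom c n)
  have "a ^ n * z \<approx> z * b ^ n"
  proof (induction n)
    case (Suc n)
    have "a ^ Suc n * z = a * (a ^ n * z)" by (simp add: mult.assoc)
    also have "\<dots> \<approx> a * (z * b ^ n)" by (intro cong_mult Suc.IH cong_refl)
    also have "\<dots> = a * z * b ^ n" by (simp add: mult.assoc)
    also have "\<dots> \<approx> z * b * b ^ n" by (intro cong_mult assms cong_refl)
    also have "\<dots> = z * b ^ Suc n" by (simp add: mult.assoc)
    finally show ?case .
  qed simp
  hence "const_poly c * (a ^ n * z) \<approx> const_poly c * (z * b ^ n)"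
    by (rule cong_mult[OF cong_refl])
  also have "\<dots> = z * (const_poly c * b ^ n)"
    by (metis const_poly_central mult.assoc)
  finally show ?case by (simp add: eval_at_monom mult.assoc)
qed (simp_all add: eval_at_add distrib_left distrib_right cong_add)

lemma cong_eval_at_right:
  assumes "z * a \<approx> b * z"
  shows "z * eval_at p a \<approx> eval_at p b * z"
  using cong_eval_at_left[OF cong_sym[OF assms], of p] by (rule cong_sym)

lemma cong_eval_h_x: "eval_at p gh * gx \<approx> gx * eval_at (pcompose p f) gh"
  using cong_eval_at_left[OF cong_h_x] by (simp add: eval_at_pcompose)

lemma cong_y_eval_h: "gy * eval_at p gh \<approx> eval_at (pcompose p f) gh * gy"
  using cong_eval_at_right[OF cong_y_h] by (simp add: eval_at_pcompose)

lemma cong_eval_h_x_power: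
  "eval_at p gh * gx ^ i \<approx> gx ^ i * eval_at (pcompose p (iterate i)) gh"
proof (induction i)
  case (Suc i)
  let ?q = "pcompose p (iterate i)"
  have "eval_at p gh * gx ^ Suc i = (eval_at p gh * gx ^ i) * gx"
    by (simp add: power_Suc2 mult.assoc del: power_Suc)
  also have "\<dots> \<approx> (gx ^ i * eval_at ?q gh) * gx" by (intro cong_mult Suc.IH cong_refl)
  also have "\<dots> = gx ^ i * (eval_at ?q gh * gx)" by (simp add: mult.assoc)
  also have "\<dots> \<approx> gx ^ i * (gx * eval_at (pcompose ?q f) gh)"
    by (intro cong_mult cong_eval_h_x cong_refl)
  also have "\<dots> = gx ^ Suc i * eval_at (pcompose p (iterate (Suc i))) gh"
    by (simp add: power_Suc2 mult.assoc iterate_Suc' pcompose_assoc del: power_Suc iterate.simps)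
  finally show ?case .
qed simp

lemma cong_y_x_power:
  "gy * gx ^ Suc i \<approx> gx ^ Suc i * gy + gx ^ i * eval_at (iterate (Suc i) - [:0, 1:]) gh"
proof (induction i)
  case 0
  show ?case using cong_y_x by (simp add: eval_at_diff eval_at_var)
next
  case (Suc i)
  let ?g = "iterate (Suc i) - [:0, 1:]"
  have "gy * gx ^ Suc (Suc i) = (gy * gx ^ Suc i) * gx"
    by (simp add: power_Suc2 mult.assoc del: power_Suc)
  also have "\<dots> \<approx> (gx ^ Suc i * gy + gx ^ i * eval_at ?g gh) * gx"
    by (intro cong_mult Suc.IH cong_refl)
  also have "\<dots> = gx ^ Suc i * (gy * gx) + gx ^ i * (eval_at ?g gh * gx)"
    by (simp only: distrib_right mult.assoc)
  also have "\<dots> \<approx> gx ^ Suc i * (gx * gy + (eval_at f gh - gh)) +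
      gx ^ i * (gx * eval_at (pcompose ?g f) gh)"
    by (intro cong_add cong_mult cong_refl cong_y_x cong_eval_h_x)
  \<comment> \<open>Substituting f into \<open>- h\<close> gives \<open>- f\<close>, which cancels
    the f(h) produced by \<open>y x\<close>; the sum telescopes.\<close>
  also have "pcompose ?g f = iterate (Suc (Suc i)) - f"
    by (simp add: pcompose_diff iterate_Suc'[symmetric] pcompose_pCons del: iterate.simps)
  also have "gx ^ Suc i * (gx * gy + (eval_at f gh - gh)) +
      gx ^ i * (gx * eval_at (iterate (Suc (Suc i)) - f) gh) =
      gx ^ Suc (Suc i) * gy + gx ^ Suc i * eval_at (iterate (Suc (Suc i)) - [:0, 1:]) gh"
    by (simp add: eval_at_diff eval_at_var power_Suc2 algebra_simps del: power_Suc iterate.simps)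
  finally show ?case .
qed

section \<open>Spanning and linear independence of the normal forms\<close>

definition lift_row :: "complex poly poly \<Rightarrow> free_poly" where
  "lift_row = coeff_sum (\<lambda>k p. eval_at p gh * gy ^ k)"

definition lift :: "normal_form \<Rightarrow> free_poly" where
  "lift = coeff_sum (\<lambda>i b. gx ^ i * lift_row b)"

lemma lift_row_0 [simp]: "lift_row 0 = 0"
  by (simp add: lift_row_def coeff_sum_0)

lemma lift_row_add: "lift_row (b + c) = lift_row b + lift_row c"
  unfolding lift_row_def by (rule coeff_sum_add) (simp_all add: eval_at_add distrib_right)

lemma lift_row_monom: "lift_row (monom p k) = eval_at p gh * gy ^ k"
  unfolding lift_row_def by (subst coeff_sum_monom) simp_all

lemma lift_0 [simp]: "lift 0 = 0"
  by (simp add: lift_def coeff_sum_0)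

lemma lift_add: "lift (m + n) = lift m + lift n"
  unfolding lift_def by (rule coeff_sum_add) (simp_all add: lift_row_add distrib_left)

lemma lift_monom: "lift (nf_monom i p k) = gx ^ i * eval_at p gh * gy ^ k"
  unfolding lift_def by (subst coeff_sum_monom) (simp_all add: lift_row_monom mult.assoc)

lemma lift_1 [simp]: "lift 1 = 1"
  using lift_monom[where i = 0 and p = 1 and k = 0] by simp

lemma lift_scale: "lift (nf_scale c m) = const_poly c * lift m"
proof (induction m rule: normal_form_induct)
  case (monom i p k)
  have "nf_scale c (nf_monom i p k) = nf_monom i ([:c:] * p) k"
    by (simp add: smult_monom)
  hence "lift (nf_scale c (nf_monom i p k)) = gx ^ i * const_poly c * (eval_at p gh * gy ^ k)"
    by (simp only: lift_monom eval_at_mult eval_at_const mult.assoc)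
  thus ?case
    by (simp add: lift_monom mult.assoc flip: const_poly_central)
qed (simp_all add: smult_add_right lift_add distrib_left)

lemma h_mult_monom: "h_mult (nf_monom i p k) = nf_monom i (iterate i * p) k"
  by (rule poly_eqI) (simp add: coeff_h_mult smult_monom)

lemma y_mult_monom:
  "y_mult (nf_monom i p k) = nf_monom i (pcompose p f) (Suc k) +
    (if i = 0 then 0 else nf_monom (i - 1) ((iterate i - [:0, 1:]) * p) k)"
  by (rule poly_eqI)
    (auto simp: coeff_y_mult y_shift_monom smult_monom simp del: iterate.simps)

text \<open>The formulas of \<open>gen_act\<close> are exactly this rewriting: h moves right through
  x^i, and y moves right through x^i and then through p(h).\<close>

lemma gen_mult_lift: "gen_poly g * lift m \<approx> lift (gen_act g m)"
proof (induction m rule: normal_form_induct)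
  case zero
  show ?case using gen_act_add[of g 0 0] by simp
next
  case (add m n)
  thus ?case by (simp add: gen_act_add lift_add distrib_left cong_add)
next
  case (monom i p k)
  show ?case
  proof (cases g)
    case GenX
    thus ?thesis by (simp add: lift_monom mult.assoc flip: monom_Suc)
  next
    case GenH
    have "gh * lift (nf_monom i p k) = (eval_at [:0, 1:] gh * gx ^ i) * (eval_at p gh * gy ^ k)"
      by (simp add: lift_monom eval_at_var mult.assoc)
    also have "\<dots> \<approx> (gx ^ i * eval_at (pcompose [:0, 1:] (iterate i)) gh) * (eval_at p gh * gy ^ k)"
      by (intro cong_mult cong_eval_h_x_power cong_refl)
    also have "\<dots> = lift (h_mult (nf_monom i p k))"
      by (simp add: h_mult_monom lift_monom eval_at_mult mult.assoc pcompose_pCons)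
    finally show ?thesis using GenH by simp
  next
    case GenY
    have *: "gx ^ i * gy * (eval_at p gh * gy ^ k) \<approx> lift (nf_monom i (pcompose p f) (Suc k))"
    proof -
      have "gx ^ i * gy * (eval_at p gh * gy ^ k) = gx ^ i * (gy * eval_at p gh) * gy ^ k"
        by (simp add: mult.assoc)
      also have "\<dots> \<approx> gx ^ i * (eval_at (pcompose p f) gh * gy) * gy ^ k"
        by (intro cong_mult cong_refl cong_y_eval_h)
      finally show ?thesis by (simp add: lift_monom mult.assoc)
    qed
    show ?thesis
    proof (cases i)
      case 0
      with * GenY show ?thesis by (simp add: lift_monom y_mult_monom mult.assoc)
    next
      case (Suc j)
      let ?g = "iterate i - [:0, 1:]"
      have "gy * lift (nf_monom i p k) = gy * gx ^ i * (eval_at p gh * gy ^ k)"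
        by (simp add: lift_monom mult.assoc)
      also have "\<dots> \<approx> (gx ^ i * gy + gx ^ j * eval_at ?g gh) * (eval_at p gh * gy ^ k)"
        unfolding Suc by (intro cong_mult cong_refl cong_y_x_power)
      also have "\<dots> = gx ^ i * gy * (eval_at p gh * gy ^ k) + lift (nf_monom j (?g * p) k)"
        by (simp only: distrib_right mult.assoc lift_monom eval_at_mult)
      also have "\<dots> \<approx> lift (nf_monom i (pcompose p f) (Suc k)) + lift (nf_monom j (?g * p) k)"
        by (intro cong_add * cong_refl)
      also have "\<dots> = lift (y_mult (nf_monom i p k))"
        using Suc by (simp add: y_mult_monom lift_add del: iterate.simps)
      finally show ?thesis using GenY by simp
    qed
  qed
qed

lemma mult_lift: "a * lift m \<approx> lift (act a m)"
proof (induction a rule: free_poly_induct)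
  case (single w c)
  have "Poly_Mapping.single (Word v) c * lift m \<approx> lift (nf_scale c (word_act v m))" for v
  proof (induction v)
    case Nil
    show ?case
      using lift_scale[of c m] by (simp add: const_poly_def zero_word_def)
  next
    case (Cons g v)
    have "Poly_Mapping.single (Word (g # v)) c * lift m =
        gen_poly g * (Poly_Mapping.single (Word v) c * lift m)"
      by (simp add: gen_poly_def mult_single plus_word_def flip: mult.assoc)
    also have "\<dots> \<approx> gen_poly g * lift (nf_scale c (word_act v m))"
      by (intro cong_mult Cons.IH cong_refl)
    also have "\<dots> \<approx> lift (gen_act g (nf_scale c (word_act v m)))"
      by (rule gen_mult_lift)
    finally show ?case by (simp add: gen_act_scale)
  qed
  from this[of "letters w"] show ?case by (simp add: act_single)
qed (simp_all add: act_add_left lift_add distrib_right cong_add)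

text \<open>This is the spanning half: a normal form is found by acting on 1.\<close>

lemma cong_lift: "a \<approx> lift (act a 1)"
  using mult_lift[of a 1] by simp

lemma gen_act_eq: "gen_act GenX = pCons 0" "gen_act GenH = h_mult" "gen_act GenY = y_mult"
  by auto

lemma y_mult_power_monom:
  "(y_mult ^^ k) (nf_monom 0 q l) = nf_monom 0 (pcompose q (iterate k)) (k + l)"
  by (induction k)
    (simp_all add: y_mult_monom iterate_Suc' pcompose_assoc[symmetric] del: iterate.simps(2))

lemma x_mult_power_monom: "(pCons 0 ^^ i) (monom b j) = monom b (i + j)"
  for b :: "'a::zero"
  by (induction i) (simp_all add: monom_Suc)

lemma act_eval_h_monom: "act (eval_at p gh) (nf_monom 0 q l) = nf_monom 0 (p * q) l"
  by (rule poly_eqI) (simp add: coeff_act_eval_h smult_monom)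

text \<open>The vector contains no x, so y merely raises its own exponent and substitutes f, and a
  single monomial results.\<close>

lemma act_lift_monom:
  "act (lift (nf_monom i p k)) (nf_monom 0 q l) = nf_monom i (p * pcompose q (iterate k)) (k + l)"
  by (simp add: lift_monom act_mult act_gen_power gen_act_eq y_mult_power_monom x_mult_power_monom
    act_eval_h_monom)

text \<open>This is linear independence modulo the ideal: the action on 1 is well defined on the
  quotient and recovers \<open>m\<close>.\<close>

lemma act_lift: "act (lift m) 1 = m"
proof (induction m rule: normal_form_induct)
  case (monom i p k)
  show ?case
    using act_lift_monom[where i = i and p = p and k = k and q = 1 and l = 0]
    by (simp add: pcompose_1)
qed (simp_all add: lift_add act_add_left)

definition nf_mult :: "normal_form \<Rightarrow> normal_form \<Rightarrow> normal_form" where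
  "nf_mult m n = act (lift m) n"

text \<open>The lift of \<open>act a 1\<close> is congruent to \<open>a\<close>, so any
  representative may serve as left factor.\<close>

lemma nf_mult_act: "nf_mult (act a 1) m = act a m"
  unfolding nf_mult_def by (rule cong_imp_act_eq[OF cong_lift, symmetric])

lemma nf_mult_add_left: "nf_mult (m + n) r = nf_mult m r + nf_mult n r"
  by (simp add: nf_mult_def lift_add act_add_left)

lemma nf_mult_add_right: "nf_mult m (n + r) = nf_mult m n + nf_mult m r"
  by (simp add: nf_mult_def act_add)

text \<open>Right multiplication by q(h) y^l never has to pass an x, hence works coefficientwise.
  The case \<open>l = 0\<close> treats right factors h and f(h), the case \<open>l = 1\<close> the
  factor y.\<close>

lemma coeff_nf_mult_monom:
  "coeff (coeff (nf_mult m (nf_monom 0 q l)) i) k =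
    (if k < l then 0 else coeff (coeff m i) (k - l) * pcompose q (iterate (k - l)))"
  by (induction m rule: normal_form_induct)
    (auto simp: nf_mult_def lift_add act_add_left distrib_right act_lift_monom)

end

section \<open>Absence of zero divisors\<close>

context heisenberg
begin

text \<open>On row \<open>l\<close> of a normal form of \<open>x\<close>-degree at most \<open>l\<close>, the operators \<open>p(h)\<close> and \<open>y\<close> act like
  \<open>p(f\<^sup>l(h))\<close> and \<open>y_shift\<close>, since row \<open>l + 1\<close> is zero.\<close>

definition top_act :: "nat \<Rightarrow> complex poly poly \<Rightarrow> complex poly poly \<Rightarrow> complex poly poly" where
  "top_act l b c = coeff_sum (\<lambda>k p. smult (pcompose p (iterate l)) ((y_shift ^^ k) c)) b"

lemma top_act_0: "top_act l 0 c = 0"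
  by (simp add: top_act_def coeff_sum_0)

lemma top_act_add: "top_act l (a + b) c = top_act l a c + top_act l b c"
  unfolding top_act_def by (rule coeff_sum_add) (simp_all add: pcompose_add smult_add_left)

lemma top_act_monom: "top_act l (monom p k) c = smult (pcompose p (iterate l)) ((y_shift ^^ k) c)"
  unfolding top_act_def by (subst coeff_sum_monom) simp_all

lemma coeff_y_shift_power:
  "coeff ((y_shift ^^ k) c) j = (if j < k then 0 else pcompose (coeff c (j - k)) (iterate k))"
  by (induction k arbitrary: j)
    (auto simp: coeff_y_shift iterate_Suc' pcompose_assoc[symmetric] simp del: iterate.simps(2))

lemma coeff_y_mult_power:
  assumes "degree m \<le> i"
  shows "coeff ((y_mult ^^ k) m) i = (y_shift ^^ k) (coeff m i)"
  using assms
proof (induction k arbitrary: i)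
  case (Suc k)
  have "(y_shift ^^ n) 0 = 0" for n by (induction n) simp_all
  \<comment> \<open>\<open>y_mult\<close> feeds row i from row i + 1; the induction hypothesis for
    that row shows that it stays zero.\<close>
  with Suc.IH[of "Suc i"] Suc.prems have "coeff ((y_mult ^^ k) m) (Suc i) = 0"
    by (simp add: coeff_eq_0)
  with Suc show ?case by (simp add: coeff_y_mult del: iterate.simps)
qed simp

lemma coeff_act_lift_row:
  assumes "degree m \<le> i"
  shows "coeff (act (lift_row b) m) i = top_act i b (coeff m i)"
proof (induction b rule: poly_monom_induct)
  case (monom p k)
  show ?case
    using coeff_y_mult_power[OF assms]
    by (simp add: lift_row_monom act_mult act_gen_power gen_act_eq coeff_act_eval_h top_act_monom)
qed (simp_all add: top_act_0 lift_row_add act_add_left top_act_add)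

lemma top_act_zero_right: "top_act l b 0 = 0"
  by (rule poly_eqI, induction b rule: poly_monom_induct)
    (auto simp: top_act_0 top_act_add top_act_monom coeff_y_shift_power)

lemma coeff_x_mult_power:
  "coeff ((pCons 0 ^^ i) m) j = (if j < i then 0 else coeff m (j - i))"
  for m :: "'a::zero poly"
  by (induction i arbitrary: j) (auto simp: coeff_pCons split: nat.split)

lemma coeff_nf_mult_top:
  "coeff (nf_mult m n) (degree m + degree n) =
    top_act (degree n) (lead_coeff m) (lead_coeff n)"
proof -
  let ?u = "\<lambda>i. act (lift_row (coeff m i)) n"
  have "nf_mult m n = (\<Sum>i\<le>degree m. (pCons 0 ^^ i) (?u i))"
    by (simp add: nf_mult_def lift_def coeff_sum_def act_sum_left act_mult act_gen_power gen_act_eq)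
  hence "coeff (nf_mult m n) (degree m + degree n) =
      (\<Sum>i\<le>degree m. coeff (?u i) (degree m + degree n - i))"
    by (simp add: coeff_sum coeff_x_mult_power)
  \<comment> \<open>A left factor without x does not raise the x-degree, so for smaller i the row in
    question lies above \<open>degree n\<close>.\<close>
  moreover have "coeff (?u i) (degree m + degree n - i) = 0" if "i < degree m" for i
    using that by (subst coeff_act_lift_row) (auto simp: coeff_eq_0 top_act_zero_right)
  hence "(\<Sum>i\<le>degree m. coeff (?u i) (degree m + degree n - i)) =
      (\<Sum>i\<in>{degree m}. coeff (?u i) (degree m + degree n - i))"
    by (intro sum.mono_neutral_right) auto
  ultimately show ?thesis by (simp add: coeff_act_lift_row)
qed

lemma degree_iterate: "degree (iterate i) = degree f ^ i"
  by (induction i) (simp_all add: degree_pcompose)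

text \<open>The leading y-terms alone reach exponent \<open>degree b + degree c\<close>. Their
  product consists of the leading coefficients composed with iterates of f, and composing with a
  nonconstant polynomial keeps them nonzero.\<close>

lemma top_act_eq_0D:
  assumes "degree f > 0" and "top_act l b c = 0"
  shows "b = 0 \<or> c = 0"
proof (rule ccontr)
  assume "\<not> (b = 0 \<or> c = 0)"
  let ?g = "\<lambda>k. pcompose (coeff b k) (iterate l) * coeff ((y_shift ^^ k) c) (degree b + degree c)"
  have "coeff (top_act l b c) (degree b + degree c) = (\<Sum>k\<le>degree b. ?g k)"
    by (simp add: top_act_def coeff_sum_def coeff_sum)
  also have "\<dots> = (\<Sum>k\<in>{degree b}. ?g k)"
    by (rule sum.mono_neutral_right) (auto simp: coeff_y_shift_power coeff_eq_0)
  also have "\<dots> \<noteq> 0"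
    using \<open>\<not> (b = 0 \<or> c = 0)\<close> \<open>degree f > 0\<close>
    by (auto simp: coeff_y_shift_power degree_iterate dest!: pcompose_eq_0)
  finally show False using assms(2) by simp
qed

lemma nf_mult_eq_0D:
  assumes "degree f > 0" and "nf_mult m n = 0"
  shows "m = 0 \<or> n = 0"
  using coeff_nf_mult_top[of m n] top_act_eq_0D[OF assms(1)] assms(2) by fastforce

end

section \<open>Derivations of the algebra on normal forms\<close>

context heisenberg
begin

text \<open>The choice of representative is immaterial, since congruent elements act alike.\<close>

definition nf_of :: "free_poly set \<Rightarrow> normal_form" where
  "nf_of A = act (SOME a. heisenberg_coset f a = A) 1"

definition of_nf :: "normal_form \<Rightarrow> free_poly set" where
  "of_nf m = heisenberg_coset f (lift m)"

lemma nf_of_coset: "nf_of (heisenberg_coset f a) = act a 1"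
  unfolding nf_of_def by (rule someI2[of _ a]) (auto intro: cong_imp_act_eq simp: cong_def)

lemma of_nf_carrier: "of_nf m \<in> carrier (heisenberg_algebra f)"
  by (simp add: of_nf_def heisenberg_algebra_sel)

lemma nf_of_nf [simp]: "nf_of (of_nf m) = m"
  by (simp add: of_nf_def nf_of_coset act_lift)

lemma of_nf_nf_of [simp]:
  assumes "A \<in> carrier (heisenberg_algebra f)"
  shows "of_nf (nf_of A) = A"
  using assms cong_lift by (auto simp: heisenberg_algebra_sel nf_of_coset of_nf_def cong_def)

lemma nf_of_add:
  assumes "A \<in> carrier (heisenberg_algebra f)" and "B \<in> carrier (heisenberg_algebra f)"
  shows "nf_of (A \<oplus>\<^bsub>heisenberg_algebra f\<^esub> B) = nf_of A + nf_of B"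
  using assms by (auto simp: heisenberg_algebra_sel nf_of_coset act_add_left)

lemma nf_of_mult:
  assumes "A \<in> carrier (heisenberg_algebra f)" and "B \<in> carrier (heisenberg_algebra f)"
  shows "nf_of (A \<otimes>\<^bsub>heisenberg_algebra f\<^esub> B) = nf_mult (nf_of A) (nf_of B)"
  using assms by (auto simp: heisenberg_algebra_sel nf_of_coset nf_mult_act act_mult)

lemma nf_of_smult:
  assumes "A \<in> carrier (heisenberg_algebra f)"
  shows "nf_of (c \<odot>\<^bsub>heisenberg_algebra f\<^esub> A) = nf_scale c (nf_of A)"
  using assms by (auto simp: heisenberg_algebra_sel nf_of_coset act_mult act_const)

lemma nf_of_zero: "nf_of \<zero>\<^bsub>heisenberg_algebra f\<^esub> = 0"
  by (simp add: heisenberg_algebra_sel nf_of_coset)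

lemma of_nf_zero: "of_nf 0 = \<zero>\<^bsub>heisenberg_algebra f\<^esub>"
  by (simp add: heisenberg_algebra_sel of_nf_def)

lemma of_nf_add: "of_nf (m + n) = of_nf m \<oplus>\<^bsub>heisenberg_algebra f\<^esub> of_nf n"
  by (simp add: of_nf_def heisenberg_algebra_sel lift_add)

lemma of_nf_mult: "of_nf (nf_mult m n) = of_nf m \<otimes>\<^bsub>heisenberg_algebra f\<^esub> of_nf n"
  using mult_lift[of "lift m" n] by (simp add: of_nf_def heisenberg_algebra_sel nf_mult_def cong_def)

lemma of_nf_scale: "of_nf (nf_scale c m) = c \<odot>\<^bsub>heisenberg_algebra f\<^esub> of_nf m"
  by (simp add: of_nf_def heisenberg_algebra_sel lift_scale)

section \<open>Generators, relations and their consequences in normal form\<close>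

abbreviation "nf_x \<equiv> gen_act GenX 1"
abbreviation "nf_y \<equiv> gen_act GenY 1"
abbreviation "nf_h \<equiv> gen_act GenH 1"
abbreviation "nf_poly p \<equiv> nf_monom 0 p 0"

lemma nf_mult_gen: "nf_mult (gen_act g 1) m = gen_act g m"
  using nf_mult_act[of "gen_poly g" m] by (simp add: act_gen)

lemma nf_mult_x: "nf_mult nf_x m = pCons 0 m"
  and nf_mult_h: "nf_mult nf_h m = h_mult m"
  by (subst nf_mult_gen, rule gen_act.simps)+

lemma nf_h_eq: "nf_h = nf_poly [:0, 1:]"
  using h_mult_monom[where i = 0 and p = 1 and k = 0] by simp

lemma nf_y_eq: "nf_y = nf_monom 0 1 1"
  using y_mult_monom[where i = 0 and p = 1 and k = 0] by (simp add: pcompose_1)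

lemma act_eval_h_1: "act (eval_at p gh) 1 = nf_poly p"
  using act_eval_h_monom[of p 1 0] by simp

lemma coeff_nf_mult_nf_poly: "coeff (nf_mult (nf_poly p) m) i = smult (pcompose p (iterate i)) (coeff m i)"
  using nf_mult_act[of "eval_at p gh" m] coeff_act_eval_h[of p m i] by (simp add: act_eval_h_1)

lemma nf_poly_Suc: "nf_poly (monom 1 (Suc i)) = nf_mult nf_h (nf_poly (monom 1 i))"
proof -
  have "nf_mult nf_h (nf_poly (monom 1 i)) = h_mult (nf_poly (monom 1 i))"
    by (rule nf_mult_h)
  thus ?thesis by (simp only: h_mult_monom) (simp add: monom_Suc)
qed

lemma nf_poly_sum: "nf_poly p = (\<Sum>i\<le>degree p. nf_scale (coeff p i) (nf_poly (monom 1 i)))"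
proof -
  have *: "nf_poly (sum g A) = (\<Sum>i\<in>A. nf_poly (g i))" for g :: "nat \<Rightarrow> complex poly" and A
    by (induction A rule: infinite_finite_induct) (simp_all add: add_monom[symmetric])
  show ?thesis
    using *[of "\<lambda>i. monom (coeff p i) i" "{..degree p}"]
    by (simp add: poly_as_sum_of_monoms smult_monom)
qed

lemma nf_h_x: "nf_mult nf_h nf_x = nf_mult nf_x (nf_poly f)"
  using cong_imp_act_eq[OF cong_h_x, of 1]
  by (simp only: act_mult act_gen act_eval_h_1 nf_mult_gen)

lemma nf_y_h: "nf_mult nf_y nf_h = nf_mult (nf_poly f) nf_y"
  using cong_imp_act_eq[OF cong_y_h, of 1] nf_mult_act[of "eval_at f gh" nf_y]
  by (simp only: act_mult act_gen act_eval_h_1 nf_mult_gen)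

text \<open>By degrees: the iterate has degree at least 2. In degree 1 this can fail, as for the
  involution \<open>-h\<close>.\<close>

lemma iterate_neq_var:
  assumes "degree f > 1"
  shows "iterate (Suc i) \<noteq> [:0, 1:]"
proof
  assume "iterate (Suc i) = [:0, 1:]"
  hence "degree f ^ Suc i = 1" by (metis degree_iterate degree_pCons_0 degree_pCons_eq one_neq_zero
    pCons_eq_0_iff One_nat_def)
  with assms show False by (metis one_less_power less_irrefl zero_less_Suc)
qed

lemma left_multiple_of_x:
  assumes "degree f > 1" and "nf_mult nf_h m = nf_mult m (nf_poly f)"
  shows "\<exists>w. m = nf_mult nf_x w"
proof -
  have "coeff (coeff m 0) k = 0" for k
  proof (rule ccontr)
    assume nz: "coeff (coeff m 0) k \<noteq> 0"
    have "coeff (coeff (nf_mult nf_h m) 0) k = [:0, 1:] * coeff (coeff m 0) k"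
      unfolding nf_h_eq coeff_nf_mult_nf_poly by (simp add: pcompose_pCons)
    moreover have "coeff (coeff (nf_mult m (nf_poly f)) 0) k = iterate (Suc k) * coeff (coeff m 0) k"
      by (simp add: coeff_nf_mult_monom mult.commute)
    ultimately show False
      using nz assms iterate_neq_var[of k] by (metis mult_right_cancel)
  qed
  hence "coeff m 0 = 0" by (simp add: poly_eq_iff)
  hence "m = pCons 0 (poly_shift 1 m)"
    by (intro poly_eqI) (simp add: coeff_pCons coeff_poly_shift split: nat.split)
  hence "m = nf_mult nf_x (poly_shift 1 m)"
    by (simp only: nf_mult_x)
  thus ?thesis ..
qed

text \<open>Mirror image of the case of x: compare the terms without y, where f(h) moving right
  through x^i becomes \<open>iterate (Suc i)\<close>.\<close>

lemma right_multiple_of_y: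
  assumes "degree f > 1" and "nf_mult m nf_h = nf_mult (nf_poly f) m"
  shows "\<exists>w. m = nf_mult w nf_y"
proof -
  have 0: "coeff (coeff m i) 0 = 0" for i
  proof (rule ccontr)
    assume nz: "coeff (coeff m i) 0 \<noteq> 0"
    have "coeff (coeff (nf_mult m nf_h) i) 0 = [:0, 1:] * coeff (coeff m i) 0"
      unfolding nf_h_eq coeff_nf_mult_monom by (simp add: pcompose_pCons)
    moreover have "coeff (coeff (nf_mult (nf_poly f) m) i) 0 = iterate (Suc i) * coeff (coeff m i) 0"
      by (simp add: coeff_nf_mult_nf_poly)
    ultimately show False
      using nz assms iterate_neq_var[of i] by (metis mult_right_cancel)
  qed
  \<comment> \<open>The witness removes one y from every term; putting it back on the right twists
    no coefficient.\<close>
  have "m = nf_mult (map_poly (poly_shift 1) m) nf_y"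
    unfolding nf_y_eq
    by (intro poly_eqI) (auto simp: coeff_nf_mult_monom coeff_map_poly coeff_poly_shift 0 pcompose_1)
  thus ?thesis ..
qed

lemma vector_space_nf_scale: "vector_space nf_scale"
  by unfold_locales (simp_all add: smult_add_right nf_scale_add_left flip: one_pCons)

end

section \<open>The derivation carried over to normal forms\<close>

locale heisenberg_derivation = heisenberg f for f +
  fixes \<delta> :: "free_poly set \<Rightarrow> free_poly set"
  assumes degree_f: "degree f > 1"
    and derivation: "is_derivation (heisenberg_algebra f) \<delta>"
    and locally_nilpotent: "is_locally_nilpotent (heisenberg_algebra f) \<delta>"
begin

definition D :: "normal_form \<Rightarrow> normal_form" where
  "D m = nf_of (\<delta> (of_nf m))"

lemma \<delta>_carrier: "A \<in> carrier (heisenberg_algebra f) \<Longrightarrow> \<delta> A \<in> carrier (heisenberg_algebra f)"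
  using derivation by (auto simp: is_derivation_def)

lemma of_nf_D: "of_nf (D m) = \<delta> (of_nf m)"
  by (simp add: D_def \<delta>_carrier of_nf_carrier)

lemma Dpow: "(D ^^ k) m = nf_of ((\<delta> ^^ k) (of_nf m))"
proof -
  have "of_nf ((D ^^ k) m) = (\<delta> ^^ k) (of_nf m)"
    by (induction k) (simp_all add: of_nf_D)
  thus ?thesis by (metis nf_of_nf)
qed

sublocale locally_nilpotent_derivation nf_scale nf_mult D
proof (intro locally_nilpotent_derivation.intro locally_nilpotent_derivation_axioms.intro
    vector_space_nf_scale)
  fix a b :: normal_form and t :: complex
  note carrier = of_nf_carrier \<delta>_carrier
  show "D (a + b) = D a + D b"
    using derivation carrier by (simp add: D_def of_nf_add nf_of_add is_derivation_def)
  show "D (nf_scale t a) = nf_scale t (D a)"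
    using derivation carrier by (simp add: D_def of_nf_scale nf_of_smult is_derivation_def)
  have "D (nf_mult a b) = nf_of (\<delta> (of_nf a) \<otimes>\<^bsub>heisenberg_algebra f\<^esub> of_nf b
      \<oplus>\<^bsub>heisenberg_algebra f\<^esub> of_nf a \<otimes>\<^bsub>heisenberg_algebra f\<^esub> \<delta> (of_nf b))"
    using derivation carrier by (simp add: D_def of_nf_mult is_derivation_def)
  also have "\<dots> = nf_mult (D a) b + nf_mult a (D b)"
    using carrier ring.ring_simprules(5)[OF ring_heisenberg_algebra]
    by (simp add: nf_of_add nf_of_mult D_def)
  finally show "D (nf_mult a b) = nf_mult (D a) b + nf_mult a (D b)" .
  obtain k where "(\<delta> ^^ k) (of_nf a) = \<zero>\<^bsub>heisenberg_algebra f\<^esub>"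
    using locally_nilpotent of_nf_carrier[of a] by (auto simp: is_locally_nilpotent_def)
  thus "\<exists>k. (D ^^ k) a = 0"
    by (intro exI[of _ k]) (simp add: Dpow nf_of_zero)
  show "a = 0 \<or> b = 0" if "nf_mult a b = 0"
    using nf_mult_eq_0D[OF _ that] degree_f by simp
qed (simp_all add: nf_mult_add_left nf_mult_add_right)

lemma D_1: "D 1 = 0"
  using D_mul[of 1 1] nf_mult_act[of 1] by (simp add: nf_mult_def act_lift)

lemma D_h: "D nf_h = 0"
proof (rule ccontr)
  assume nz: "D nf_h \<noteq> 0"
  hence "nf_h \<noteq> 0" by auto
  then obtain d where d: "has_degree nf_h d" by (rule has_degree_exists)
  from has_degree_D[OF d nz] have "d > 0" by auto
  have "nf_x \<noteq> 0" by simp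
  then obtain e where e: "has_degree nf_x e" by (rule has_degree_exists)
  \<comment> \<open>Additivity of the degree on powers of h; the base case rests on
    \<open>D 1 = 0\<close>.\<close>
  have "has_degree (nf_poly (monom 1 i)) (i * d)" for i
  proof (induction i)
    case 0
    have "nf_poly (monom 1 0) = 1" by simp
    thus ?case using D_1 by (simp add: has_degree_def)
  next
    case (Suc i)
    show ?case using has_degree_mul[OF d Suc.IH] by (simp only: nf_poly_Suc mult_Suc)
  qed
  hence "has_degree (nf_poly f) (degree f * d)"
    unfolding nf_poly_sum[of f] using degree_f \<open>d > 0\<close>
    by (intro has_degree_linear_combination) auto
  hence "has_degree (nf_mult nf_x (nf_poly f)) (e + degree f * d)"
    by (rule has_degree_mul[OF e])
  moreover have "has_degree (nf_mult nf_x (nf_poly f)) (d + e)"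
    unfolding nf_h_x[symmetric] by (rule has_degree_mul[OF d e])
  ultimately have "d + e = e + degree f * d" by (metis has_degree_unique)
  with degree_f \<open>d > 0\<close> show False by simp
qed

lemma D_nf_poly: "D (nf_poly p) = 0"
proof -
  have "D (nf_poly (monom 1 i)) = 0" for i
    by (induction i) (simp_all add: D_1 nf_poly_Suc D_mul D_h del: gen_act.simps)
  moreover have "D (sum g A) = (\<Sum>i\<in>A. D (g i))" for g :: "nat \<Rightarrow> normal_form" and A
    using Dpow_sum[of 1 g A] by simp
  ultimately show ?thesis by (subst nf_poly_sum) (simp only: D_scale, simp)
qed

lemma D_x: "D nf_x = 0"
proof -
  have "nf_mult nf_h (D nf_x) = nf_mult (D nf_x) (nf_poly f)"
    using D_mul[of nf_h nf_x] D_mul[of nf_x "nf_poly f"] nf_h_x D_h D_nf_poly[of f] by simp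
  from left_multiple_of_x[OF degree_f this] show ?thesis
    using D_eq_mul_left_imp_0 by blast
qed

lemma D_y: "D nf_y = 0"
proof -
  have "nf_mult (D nf_y) nf_h = nf_mult (nf_poly f) (D nf_y)"
    using D_mul[of nf_y nf_h] D_mul[of "nf_poly f" nf_y] nf_y_h D_h D_nf_poly[of f] by simp
  from right_multiple_of_y[OF degree_f this] show ?thesis
    using D_eq_mul_right_imp_0 by blast
qed

lemma D_eq_0: "D m = 0"
proof -
  have "D (gen_act g 1) = 0" for g
    using D_x D_y D_h by (cases g) simp_all
  \<comment> \<open>\<open>gen_act g\<close> is left multiplication by the normal form of g, so the
    Leibniz rule runs along the word; linearity and \<open>lift\<close> then reach every normal
    form.\<close>
  hence "D (word_act w 1) = 0" for w
    by (induction w) (simp_all add: D_1 D_mul nf_mult_gen[symmetric, of _ "word_act _ _"])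
  hence "D (act a 1) = 0" for a
    by (induction a rule: free_poly_induct) (simp_all add: act_single D_scale act_add_left D_add)
  from this[of "lift m"] show ?thesis by (simp add: act_lift)
qed

lemma \<delta>_eq_0:
  assumes "A \<in> carrier (heisenberg_algebra f)"
  shows "\<delta> A = \<zero>\<^bsub>heisenberg_algebra f\<^esub>"
  using of_nf_D[of "nf_of A"] assms by (simp add: D_eq_0 of_nf_zero)

end

theorem corollary4p9:
  fixes f :: "complex poly" and \<delta> :: "free_poly set \<Rightarrow> free_poly set"
  assumes "degree f > 1"
    and "is_derivation (heisenberg_algebra f) \<delta>"
    and "is_locally_nilpotent (heisenberg_algebra f) \<delta>"
  shows "\<forall>a\<in>carrier (heisenberg_algebra f). \<delta> a = \<zero>\<^bsub>heisenberg_algebra f\<^esub>"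
proof -
  interpret heisenberg_derivation f \<delta>
    using assms by unfold_locales
  show ?thesis using \<delta>_eq_0 by blast
qed

end
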